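(* For all real parameters $c_1>0$, $c_2>0$, $k_1>0$, $k_2>0$, the map $F$ (the Bertrand duopoly map for $\alpha=1/2$, defined in the context) has exactly one equilibrium $(p_1,p_2)$ with $p_1>0$ and $p_2>0$, i.e. there is exactly one pair $(p_1,p_2)$ of positive reals with $F(p_1,p_2)=(p_1,p_2)$.
   Context: For $\alpha=1/2$ (so $\beta=\alpha/(1-\alpha)=1$) the dynamic Bertrand duopoly game with differentiated products is the iteration $(p_1(t+1),p_2(t+1))=F(p_1(t),p_2(t))$ with $$F(p_1,p_2)=\left(p_1+k_1\frac{-p_2p_1^2+(p_2^2+2p_1p_2)c_1}{p_1^2(p_1+p_2)^2},\;\; p_2+k_2\frac{-p_1p_2^2+(p_1^2+2p_1p_2)c_2}{p_2^2(p_1+p_2)^2}\right),\qquad p_1,p_2>0.$$ Here $p_i$ is the price set by firm $i$, $c_i>0$ is its marginal cost, and $k_i>0$ is its adjustment speed. An equilibrium is a fixed point of $F$. *)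

theory Defs
  imports Complex_Main
begin

text \<open>The price map of the differentiated Bertrand duopoly at \<open>\<alpha> = 1/2\<close>, with marginal costs
  \<open>c1\<close>, \<open>c2\<close> and adjustment speeds \<open>k1\<close>, \<open>k2\<close>. The model only concerns positive prices; the values
  of this total function elsewhere (where denominators may vanish) have no meaning.\<close>

definition bertrand_map :: "real \<Rightarrow> real \<Rightarrow> real \<Rightarrow> real \<Rightarrow> real \<times> real \<Rightarrow> real \<times> real" where
  "bertrand_map c1 c2 k1 k2 = (\<lambda>(p1, p2).
     (p1 + k1 * ((- p2 * p1\<^sup>2 + (p2\<^sup>2 + 2 * p1 * p2) * c1) / (p1\<^sup>2 * (p1 + p2)\<^sup>2)),
      p2 + k2 * ((- p1 * p2\<^sup>2 + (p1\<^sup>2 + 2 * p1 * p2) * c2) / (p2\<^sup>2 * (p1 + p2)\<^sup>2))))"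

definition bertrand_equilibrium :: "real \<Rightarrow> real \<Rightarrow> real \<Rightarrow> real \<Rightarrow> real \<times> real \<Rightarrow> bool" where
  "bertrand_equilibrium c1 c2 k1 k2 p \<longleftrightarrow> bertrand_map c1 c2 k1 k2 p = p"

end

(* In the price ratio t = p2/p1 the equilibrium conditions p1^2 = c1 (p2 + 2 p1) and
   p2^2 = c2 (p1 + 2 p2) become p1 = c1 (t + 2) and c1 t^2 (t + 2) = c2 (1 + 2 t). The cubic in t
   has exactly one positive root: one exists by the intermediate value theorem, and it is unique
   since t^2 (t + 2) / (1 + 2 t) is strictly increasing for t > 0. *)
theory Submission
  imports Defs
begin

text \<open>The numerator of the increment factors as
  \<open>q * (c * (q + 2 * p) - p\<^sup>2)\<close>; as \<open>k\<close>, \<open>q\<close> and the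
  denominator are nonzero, only the bracket can vanish. One firm is treated, and swapping the roles
  of the prices covers the other.\<close>

lemma price_fixed_iff:
  fixes p q c k :: real
  assumes "p > 0" "q > 0" "k > 0"
  shows "p + k * ((- q * p\<^sup>2 + (q\<^sup>2 + 2 * p * q) * c) / (p\<^sup>2 * (p + q)\<^sup>2)) = p
    \<longleftrightarrow> p\<^sup>2 = c * (q + 2 * p)"
proof -
  have "- q * p\<^sup>2 + (q\<^sup>2 + 2 * p * q) * c = q * (c * (q + 2 * p) - p\<^sup>2)"
    by (simp add: algebra_simps power2_eq_square)
  moreover have "p\<^sup>2 * (p + q)\<^sup>2 \<noteq> 0"
    using assms by simp
  ultimately show ?thesis
    using assms by auto
qed

lemma bertrand_equilibrium_iff:
  assumes "p1 > 0" "p2 > 0" "k1 > 0" "k2 > 0"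
  shows "bertrand_equilibrium c1 c2 k1 k2 (p1, p2)
    \<longleftrightarrow> p1\<^sup>2 = c1 * (p2 + 2 * p1) \<and> p2\<^sup>2 = c2 * (p1 + 2 * p2)"
  using price_fixed_iff[of p1 p2 k1 c1] price_fixed_iff[of p2 p1 k2 c2] assms
  by (simp add: bertrand_equilibrium_def bertrand_map_def add.commute mult.commute mult.left_commute)

text \<open>After cross-multiplication the difference of the two sides is \<open>t - s\<close> times
  a polynomial with positive coefficients.\<close>

lemma ratio_cubic_strict_mono:
  fixes s t :: real
  assumes "0 < s" "s < t"
  shows "s\<^sup>2 * (s + 2) / (1 + 2 * s) < t\<^sup>2 * (t + 2) / (1 + 2 * t)"
proof -
  have "t\<^sup>2 * (t + 2) * (1 + 2 * s) - s\<^sup>2 * (s + 2) * (1 + 2 * t)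
      = (t - s) * (t\<^sup>2 + s * t + s\<^sup>2 + 2 * (s + t) + 2 * s * t * (s + t) + 4 * s * t)"
    by (simp add: algebra_simps power2_eq_square)
  also have "\<dots> > 0"
    using assms by (intro mult_pos_pos add_pos_pos) auto
  finally show ?thesis
    using assms by (simp add: field_simps)
qed

lemma ratio_cubic_ex1_root:
  fixes c1 c2 :: real
  assumes "c1 > 0" "c2 > 0"
  shows "\<exists>!t. t > 0 \<and> c1 * (t\<^sup>2 * (t + 2)) = c2 * (1 + 2 * t)"
proof (rule ex_ex1I)
  let ?f = "\<lambda>t::real. c1 * (t\<^sup>2 * (t + 2)) - c2 * (1 + 2 * t)"
  \<comment> \<open>\<open>M\<close> is large enough for \<open>?f M \<ge> 0\<close>:
    \<open>c1 * M \<ge> c2\<close> bounds the linear side, and \<open>M \<ge> 1\<close> gives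
    \<open>1 + 2 * M \<le> M * (M + 2)\<close>.\<close>
  define M where "M = 1 + c2 / c1"
  have M: "M \<ge> 1" "c1 * M \<ge> c2"
    using assms by (auto simp: M_def field_simps)
  have "c2 * (1 + 2 * M) \<le> c1 * M * (1 + 2 * M)"
    using M by (intro mult_right_mono) auto
  also have "\<dots> \<le> c1 * M * (M * (M + 2))"
  proof (intro mult_left_mono)
    show "1 + 2 * M \<le> M * (M + 2)"
      using mult_mono[of 1 M 1 M] M by (simp add: algebra_simps)
  qed (use M assms in auto)
  finally have "?f M \<ge> 0"
    by (simp add: power2_eq_square mult.assoc)
  moreover have "?f 0 \<le> 0"
    using assms by simp
  moreover have "continuous_on {0..M} ?f"
    by (intro continuous_intros)
  ultimately obtain t where t: "0 \<le> t" "?f t = 0"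
    using IVT'[of ?f 0 0 M] M by auto
  \<comment> \<open>The intermediate value theorem allows the endpoint 0, but there
    \<open>?f\<close> equals \<open>- c2 < 0\<close>.\<close>
  moreover have "t \<noteq> 0"
    using t assms by auto
  ultimately show "\<exists>t. t > 0 \<and> c1 * (t\<^sup>2 * (t + 2)) = c2 * (1 + 2 * t)"
    by (intro exI[of _ t]) auto
next
  fix s t :: real
  assume s: "s > 0 \<and> c1 * (s\<^sup>2 * (s + 2)) = c2 * (1 + 2 * s)"
    and t: "t > 0 \<and> c1 * (t\<^sup>2 * (t + 2)) = c2 * (1 + 2 * t)"
  have "u\<^sup>2 * (u + 2) / (1 + 2 * u) = c2 / c1"
    if "u > 0 \<and> c1 * (u\<^sup>2 * (u + 2)) = c2 * (1 + 2 * u)" for u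
    using that assms by (simp add: frac_eq_eq mult.commute)
  with s t show "s = t"
    using ratio_cubic_strict_mono[of s t] ratio_cubic_strict_mono[of t s]
    by (metis less_irrefl linorder_neqE_linordered_idom)
qed

text \<open>Putting \<open>p2 = t * p1\<close> and cancelling \<open>p1\<close> makes the first
  equation linear in \<open>p1\<close>; inserting its solution into the second leaves a condition on
  \<open>t\<close> alone.\<close>

lemma equilibrium_ratio_iff:
  fixes c1 c2 p1 p2 :: real
  assumes "p1 > 0"
  shows "p1\<^sup>2 = c1 * (p2 + 2 * p1) \<and> p2\<^sup>2 = c2 * (p1 + 2 * p2)
    \<longleftrightarrow> p1 = c1 * (p2 / p1 + 2) \<and> c1 * ((p2 / p1)\<^sup>2 * (p2 / p1 + 2)) = c2 * (1 + 2 * (p2 / p1))"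
proof -
  define t where "t = p2 / p1"
  have p2: "p2 = t * p1"
    using assms by (simp add: t_def)
  have "p1\<^sup>2 = c1 * (p2 + 2 * p1) \<longleftrightarrow> p1 * p1 = p1 * (c1 * (t + 2))"
    by (simp add: p2 power2_eq_square algebra_simps)
  then have 1: "p1\<^sup>2 = c1 * (p2 + 2 * p1) \<longleftrightarrow> p1 = c1 * (t + 2)"
    using assms by simp
  have "p2\<^sup>2 = c2 * (p1 + 2 * p2) \<longleftrightarrow> p1 * (t\<^sup>2 * p1) = p1 * (c2 * (1 + 2 * t))"
    by (simp add: p2 power2_eq_square algebra_simps)
  then have 2: "p2\<^sup>2 = c2 * (p1 + 2 * p2) \<longleftrightarrow> t\<^sup>2 * p1 = c2 * (1 + 2 * t)"
    using assms by simp
  show ?thesis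
    unfolding 1 2 t_def[symmetric] by (metis mult.left_commute)
qed

theorem proposition1:
  fixes c1 c2 k1 k2 :: real
  assumes "c1 > 0" and "c2 > 0" and "k1 > 0" and "k2 > 0"
  shows "\<exists>!p. fst p > 0 \<and> snd p > 0 \<and> bertrand_equilibrium c1 c2 k1 k2 p"
proof -
  obtain t where t: "t > 0" "c1 * (t\<^sup>2 * (t + 2)) = c2 * (1 + 2 * t)"
    and t_unique: "\<And>s. s > 0 \<Longrightarrow> c1 * (s\<^sup>2 * (s + 2)) = c2 * (1 + 2 * s) \<Longrightarrow> s = t"
    using ratio_cubic_ex1_root[OF assms(1,2)] by blast
  \<comment> \<open>The first equilibrium equation forces this price once the ratio is
    \<open>t\<close>.\<close>
  define p1 where "p1 = c1 * (t + 2)"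
  have p1: "p1 > 0"
    using t assms by (simp add: p1_def)
  show ?thesis
  proof (rule ex1I[of _ "(p1, t * p1)"])
    show "fst (p1, t * p1) > 0 \<and> snd (p1, t * p1) > 0
        \<and> bertrand_equilibrium c1 c2 k1 k2 (p1, t * p1)"
      using p1 t assms equilibrium_ratio_iff[of p1 c1 "t * p1" c2]
      by (simp add: bertrand_equilibrium_iff p1_def)
  next
    fix q
    assume q: "fst q > 0 \<and> snd q > 0 \<and> bertrand_equilibrium c1 c2 k1 k2 q"
    obtain q1 q2 where [simp]: "q = (q1, q2)"
      by fastforce
    have pos: "q1 > 0" "q2 > 0"
      using q by auto
    then have eqs: "q1 = c1 * (q2 / q1 + 2)"
        "c1 * ((q2 / q1)\<^sup>2 * (q2 / q1 + 2)) = c2 * (1 + 2 * (q2 / q1))"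
      using q assms bertrand_equilibrium_iff[of q1 q2 k1 k2 c1 c2]
        equilibrium_ratio_iff[of q1 c1 q2 c2] by auto
    \<comment> \<open>Any equilibrium has a positive ratio solving the cubic, so it shares
      \<open>t\<close>, which then fixes both prices.\<close>
    have ratio: "q2 / q1 = t"
      by (rule t_unique[OF _ eqs(2)]) (use pos in simp)
    then have "q1 = p1"
      using eqs(1) by (simp add: p1_def)
    with ratio pos show "q = (p1, t * p1)"
      by (auto simp: field_simps)
  qed
qed

end
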